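(* Let $0<\delta<1$. There exists a constant $C>0$ depending only on $\delta$ such that for all $k>0$, $R>0$ and $0<\beta<\pi$ the function $s\mapsto g(s;R,\beta)$ is analytic and bounded in $$\mathcal{S}^\delta_{R,\beta}=\Big\{s\in\mathbb{C}:\ |\mathrm{Im}\,s|<(1-\delta)R\sin\beta\ \text{ and }\ |\arg s|<\arctan\sqrt{(11+5\sqrt5)/2}\Big\},$$ with $$|g(s;R,\beta)|\le Ck\Big(1+\frac{1}{\sqrt{kR\sin\beta}}\Big),\qquad s\in\mathcal{S}^\delta_{R,\beta}.$$
   Context: For $k>0$, $R>0$, $0<\beta<\pi$, all complex square roots taking principal values, define $$r(s)=\sqrt{R^2+s^2-2sR\cos\beta},\qquad \mu(s)=\frac{\sqrt k\,s\sin\beta}{\sqrt{R-s\cos\beta+r(s)}},$$ $${\rm Fr}(z)=\tfrac12{\rm erfc}(e^{-i\pi/4}z),\qquad F(z)=e^{-iz^2}{\rm Fr}(z),$$ $$f(s;R,\beta)=F(\mu(s)),\qquad h(s;R,\beta)=\frac{k\sin\beta\,(r(s)-R)}{2r(s)\mu(s)},$$ $$g(s;R,\beta)=\frac{e^{3\pi i/4}}{\sqrt\pi}\,h(s;R,\beta)-ik\sin\beta\,f(s;R,\beta).$$ These formulas define $g$ for real $s>0$ and give its analytic continuation to complex $s$ (the singularity of $h$ at $s=0$ is removable; the branch cuts of $r$ are $\{R\cos\beta+iy:|y|\ge R\sin\beta\}$). Here $\arg s\in(-\pi,\pi]$. *)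

theory Defs
  imports "HOL-Complex_Analysis.Complex_Analysis"
begin

definition erfc :: "complex \<Rightarrow> complex" where
  "erfc z = 1 - 2 / of_real (sqrt pi) * contour_integral (linepath 0 z) (\<lambda>t. exp (- t\<^sup>2))"

definition Fr :: "complex \<Rightarrow> complex" where
  "Fr z = 1/2 * erfc (exp (- (\<i> * of_real pi / 4)) * z)"

definition FF :: "complex \<Rightarrow> complex" where
  "FF z = exp (- (\<i> * z\<^sup>2)) * Fr z"

definition rr :: "real \<Rightarrow> real \<Rightarrow> complex \<Rightarrow> complex" where
  "rr R \<beta> s = csqrt (of_real (R\<^sup>2) + s\<^sup>2 - 2 * s * of_real R * of_real (cos \<beta>))"

definition mu :: "real \<Rightarrow> real \<Rightarrow> real \<Rightarrow> complex \<Rightarrow> complex" where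
  "mu k R \<beta> s = of_real (sqrt k) * s * of_real (sin \<beta>)
     / csqrt (of_real R - s * of_real (cos \<beta>) + rr R \<beta> s)"

definition ff :: "real \<Rightarrow> real \<Rightarrow> real \<Rightarrow> complex \<Rightarrow> complex" where
  "ff k R \<beta> s = FF (mu k R \<beta> s)"

definition h_formula :: "real \<Rightarrow> real \<Rightarrow> real \<Rightarrow> complex \<Rightarrow> complex" where
  "h_formula k R \<beta> s = of_real k * of_real (sin \<beta>) * (rr R \<beta> s - of_real R)
     / (2 * rr R \<beta> s * mu k R \<beta> s)"

text \<open>The quotient is \<open>0 / 0\<close> at \<open>s = 0\<close>, where the singularity is removable;
  the value there is the limit.\<close>

definition hh :: "real \<Rightarrow> real \<Rightarrow> real \<Rightarrow> complex \<Rightarrow> complex" where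
  "hh k R \<beta> s = (if s = 0 then Lim (at 0) (h_formula k R \<beta>) else h_formula k R \<beta> s)"

text \<open>On the principal branches, \<open>rr\<close> has exactly the cuts \<open>Re s = R cos \<beta>\<close>,
  \<open>\<bar>Im s\<bar> \<ge> R sin \<beta>\<close>, and the radicand in \<open>mu\<close> avoids the negative real axis off these
  cuts, so the formulas themselves give the analytic continuation from \<open>s > 0\<close>.\<close>

definition gg :: "real \<Rightarrow> real \<Rightarrow> real \<Rightarrow> complex \<Rightarrow> complex" where
  "gg k R \<beta> s = exp (3 * of_real pi * \<i> / 4) / of_real (sqrt pi) * hh k R \<beta> s
     - \<i> * of_real k * of_real (sin \<beta>) * ff k R \<beta> s"

text \<open>The origin has no argument, hence does not belong to the region; it is excluded
  explicitly because of the library convention \<open>Arg 0 = 0\<close>.\<close>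

definition S_region :: "real \<Rightarrow> real \<Rightarrow> real \<Rightarrow> complex set" where
  "S_region \<delta> R \<beta> = {s. s \<noteq> 0 \<and> \<bar>Im s\<bar> < (1 - \<delta>) * R * sin \<beta>
     \<and> \<bar>Arg s\<bar> < arctan (sqrt ((11 + 5 * sqrt 5) / 2))}"

end

theory Submission
  imports Defs "HOL-Probability.Distributions" "HOL-Real_Asymp.Real_Asymp"
begin

text \<open>
  Since \<open>(R - s cos \<beta> + r) (r - R + s cos \<beta>) = s\<^sup>2 sin\<^sup>2 \<beta>\<close>, one has
  \<open>\<mu>\<^sup>2 = k (r - R + s cos \<beta>)\<close>. The function \<open>F\<close> is bounded on the closed right half-plane, so
  the term with \<open>f\<close> is \<open>O(k)\<close> as soon as \<open>Re \<mu> > 0\<close>. Since \<open>\<mu> > 0\<close> on the positive axis, this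
  can only fail if \<open>\<mu>\<^sup>2 = - k p\<close> with \<open>p \<ge> 0\<close> somewhere in the region; then \<open>s\<close> solves a real
  quadratic equation, and with \<open>c = cos \<beta>\<close> the strip forces
  \<open>(Im s / Re s)\<^sup>2 > (1 + c) / (c\<^sup>2 (1 - c))\<close>, whose minimum over \<open>0 < c < 1\<close> is
  \<open>(11 + 5 \<surd>5) / 2\<close>, attained at the inverse golden ratio. For the other term, cancelling \<open>s\<close> in
  \<open>r - R = s (s - 2 R c) / (r + R)\<close> leaves
  \<open>h = \<surd>k (s - 2 R c) \<surd>(R - s c + r) / (2 r (r + R))\<close>, and in the strip \<open>|r| \<ge> \<delta> R sin \<beta>\<close>.
\<close>

section \<open>The Gaussian primitive, \<open>erfc\<close> and the boundedness of
  \<open>FF\<close>\<close>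

definition gauss_prim :: "complex \<Rightarrow> complex" where
  "gauss_prim z = contour_integral (linepath 0 z) (\<lambda>t. exp (- t\<^sup>2))"

text \<open>The integrand is entire, so it has a primitive \<open>G\<close> on the whole plane, and
  the integral along the segment is \<open>G z - G 0\<close>.\<close>

lemma has_field_derivative_gauss_prim:
  "(gauss_prim has_field_derivative exp (- z\<^sup>2)) (at z)"
proof -
  have "(\<lambda>t::complex. exp (- t\<^sup>2)) holomorphic_on UNIV"
    by (intro holomorphic_intros)
  then obtain G where G: "\<And>x::complex. (G has_field_derivative exp (- x\<^sup>2)) (at x)"
    using holomorphic_convex_primitive'[OF convex_UNIV open_UNIV] by (metis UNIV_I)
  have "gauss_prim w = G w - G 0" for w
    unfolding gauss_prim_def
    using contour_integral_primitive[of UNIV G "\<lambda>t. exp (- t\<^sup>2)" "linepath 0 w", OF G]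
    by (intro contour_integral_unique) simp
  hence "gauss_prim = (\<lambda>w. G w - G 0)"
    by auto
  thus ?thesis
    using DERIV_diff[OF G[of z] DERIV_const[of "G 0"]] by simp
qed

lemmas has_field_derivative_gauss_prim' [derivative_intros] =
  DERIV_chain2[OF has_field_derivative_gauss_prim]

lemma gauss_prim_0: "gauss_prim 0 = 0"
  by (simp add: gauss_prim_def)

text \<open>Evenness of the integrand makes the sum of both sides' values have derivative zero, and
  it vanishes at the origin. This yields the reflection formula for \<open>erfc\<close>.\<close>

lemma gauss_prim_minus: "gauss_prim (- z) = - gauss_prim z"
proof -
  let ?f = "\<lambda>z. gauss_prim (- z) + gauss_prim z"
  have "(?f has_field_derivative 0) (at x)" for x
    by (rule derivative_eq_intros refl)+ simp
  hence "?f constant_on UNIV"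
    by (intro has_field_derivative_0_imp_constant_on) auto
  then obtain c where c: "?f x = c" for x
    unfolding constant_on_def by auto
  have "?f z = 0"
    unfolding c using c[of 0] by (simp add: gauss_prim_0)
  thus ?thesis
    by (simp add: add_eq_0_iff)
qed

lemma erfc_eq: "erfc z = 1 - 2 / of_real (sqrt pi) * gauss_prim z"
  by (simp add: erfc_def gauss_prim_def)

lemma has_vector_derivative_gauss_prim_of_real:
  "((\<lambda>x. gauss_prim (of_real x)) has_vector_derivative of_real (exp (- x\<^sup>2))) (at x within A)"
proof -
  have "((gauss_prim \<circ> complex_of_real) has_vector_derivative (1 * exp (- (of_real x)\<^sup>2))) (at x within A)"
    by (rule field_vector_diff_chain_within)
       (use has_field_derivative_at_within[OF has_field_derivative_gauss_prim] in
         \<open>auto intro!: derivative_eq_intros\<close>)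
  thus ?thesis
    by (simp add: o_def exp_of_real flip: of_real_power of_real_minus)
qed

text \<open>The truncated Gaussian integrals are values of the primitive by the fundamental theorem
  of calculus; they converge to the integral over the half-line.\<close>

lemma gauss_prim_of_real_tendsto:
  "((\<lambda>x. gauss_prim (of_real x)) \<longlongrightarrow> of_real (sqrt pi / 2)) at_top"
proof -
  let ?f = "\<lambda>x::real. complex_of_real (indicator {0..} x *\<^sub>R exp (- x\<^sup>2))"
  have *: "has_bochner_integral lborel ?f (of_real (sqrt pi / 2))"
    by (intro has_bochner_integral_of_real gaussian_moment_0)
  have 1: "((\<lambda>y. \<integral>x. indicator {..y} x *\<^sub>R ?f x \<partial>lborel) \<longlongrightarrow> (\<integral>x. ?f x \<partial>lborel)) at_top"
    using * by (intro tendsto_integral_at_top) (auto simp: has_bochner_integral_iff)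
  have 2: "(\<integral>x. ?f x \<partial>lborel) = of_real (sqrt pi / 2)"
    using * by (auto simp: has_bochner_integral_iff)
  have 3: "\<forall>\<^sub>F y in at_top. (\<integral>x. indicator {..y} x *\<^sub>R ?f x \<partial>lborel) = gauss_prim (of_real y)"
    using eventually_ge_at_top[of 0]
  proof eventually_elim
    case (elim y)
    have "(\<integral>x. indicator {..y} x *\<^sub>R ?f x \<partial>lborel)
        = (\<integral>x. indicator {0..y} x *\<^sub>R complex_of_real (exp (- x\<^sup>2)) \<partial>lborel)"
      by (rule Bochner_Integration.integral_cong) (auto simp: indicator_def)
    also have "\<dots> = gauss_prim (of_real y) - gauss_prim (of_real 0)"
      using elim by (intro integral_FTC_atLeastAtMost has_vector_derivative_gauss_prim_of_real)
        (auto intro!: continuous_intros)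
    finally show ?case
      by (simp add: gauss_prim_0)
  qed
  from Lim_transform_eventually[OF 1 3] show ?thesis
    unfolding 2 .
qed

text \<open>On the segment from \<open>x\<close> to \<open>z + x\<close> with
  \<open>x \<ge> 0\<close> the real part is at least \<open>x\<close> and the imaginary part at most
  \<open>\<bar>Im z\<bar>\<close> in modulus. The integrand is thus superexponentially small in
  \<open>x\<close>, and moving the ray off the real axis does not change the limit.\<close>

lemma gauss_prim_add_of_real_tendsto:
  assumes "0 \<le> Re z"
  shows "((\<lambda>x. gauss_prim (z + of_real x)) \<longlongrightarrow> of_real (sqrt pi / 2)) at_top"
proof -
  have bnd: "norm (gauss_prim (z + of_real x) - gauss_prim (of_real x))
      \<le> exp ((Im z)\<^sup>2 - x\<^sup>2) * norm z" if "0 \<le> x" for x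
  proof -
    have "norm (gauss_prim (z + of_real x) - gauss_prim (of_real x))
        \<le> exp ((Im z)\<^sup>2 - x\<^sup>2) * norm (z + of_real x - of_real x)"
    proof (rule field_differentiable_bound)
      show "convex (closed_segment (of_real x) (z + of_real x))" by simp
      show "(gauss_prim has_field_derivative exp (- w\<^sup>2)) (at w within closed_segment (of_real x) (z + of_real x))"
        for w
        by (rule has_field_derivative_at_within[OF has_field_derivative_gauss_prim])
    next
      fix w assume "w \<in> closed_segment (of_real x) (z + of_real x)"
      then obtain u where u: "0 \<le> u" "u \<le> 1" "w = of_real x + of_real u * z"
        by (auto simp: in_segment scaleR_conv_of_real algebra_simps)
      have "x\<^sup>2 \<le> (x + u * Re z)\<^sup>2"
        using that assms u by (intro power_mono) auto
      moreover have "(u * Im z)\<^sup>2 \<le> 1 * (Im z)\<^sup>2"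
        unfolding power_mult_distrib using u by (intro mult_right_mono) (auto simp: power_le_one)
      ultimately show "norm (exp (- w\<^sup>2)) \<le> exp ((Im z)\<^sup>2 - x\<^sup>2)"
        using u by (simp add: Re_power2 del: power_mult_distrib)
    qed auto
    thus ?thesis by simp
  qed
  have "((\<lambda>x. exp ((Im z)\<^sup>2 - x\<^sup>2) * norm z) \<longlongrightarrow> 0) at_top"
    by real_asymp
  hence "((\<lambda>x. gauss_prim (z + of_real x) - gauss_prim (of_real x)) \<longlongrightarrow> 0) at_top"
    by (rule Lim_null_comparison[rotated])
       (use eventually_ge_at_top[of 0] in \<open>eventually_elim, use bnd in auto\<close>)
  from tendsto_add[OF this gauss_prim_of_real_tendsto] show ?thesis
    by simp
qed

text \<open>Integrating along the horizontal ray from \<open>z\<close> gives the integrand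
  \<open>exp (- t\<^sup>2 - 2 z t)\<close> after multiplication by \<open>exp (z\<^sup>2)\<close>.\<close>

lemma norm_exp_erfc_le_1:
  assumes "0 \<le> Re z"
  shows "norm (exp (z\<^sup>2) * erfc z) \<le> 1"
proof -
  have le: "norm (exp (z\<^sup>2) * gauss_prim (z + of_real x) - exp (z\<^sup>2) * gauss_prim z)
     \<le> Re (gauss_prim (of_real x))" if "0 < x" for x
  proof -
    have d1: "((\<lambda>t. exp (z\<^sup>2) * gauss_prim (z + of_real t)) has_vector_derivative
        (exp (z\<^sup>2) * exp (- (z + of_real t)\<^sup>2))) (at t within A)" for t A
    proof -
      have "(((\<lambda>w. exp (z\<^sup>2) * gauss_prim (z + w)) \<circ> complex_of_real) has_vector_derivative
          (1 * (exp (z\<^sup>2) * exp (- (z + of_real t)\<^sup>2)))) (at t within A)"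
        by (rule field_vector_diff_chain_within)
           (auto intro!: derivative_eq_intros)
      thus ?thesis by (simp add: o_def)
    qed
    have d2: "((\<lambda>t. Re (gauss_prim (of_real t))) has_vector_derivative exp (- t\<^sup>2)) (at t within A)" for t A
      using bounded_linear.has_vector_derivative[OF bounded_linear_Re
          has_vector_derivative_gauss_prim_of_real[of t A]] by simp
    \<comment> \<open>Mean value inequality: the derivative on the left is dominated by the one on
      the right, since \<open>z\<^sup>2 - (z + t)\<^sup>2 = - t\<^sup>2 - 2 * z * t\<close> and
      \<open>t * Re z \<ge> 0\<close>.\<close>
    have "norm (exp (z\<^sup>2) * gauss_prim (z + of_real x) - exp (z\<^sup>2) * gauss_prim (z + of_real 0))
      \<le> Re (gauss_prim (of_real x)) - Re (gauss_prim (of_real 0))"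
    proof (rule differentiable_bound_general)
      show "continuous_on {0..x} (\<lambda>t. exp (z\<^sup>2) * gauss_prim (z + of_real t))"
        using d1 by (rule continuous_on_vector_derivative)
      show "continuous_on {0..x} (\<lambda>t. Re (gauss_prim (of_real t)))"
        using d2 by (rule continuous_on_vector_derivative)
      fix t assume t: "0 < t" "t < x"
      show "norm (exp (z\<^sup>2) * exp (- (z + of_real t)\<^sup>2)) \<le> exp (- t\<^sup>2)"
        using assms t by (simp add: Re_power2 norm_mult power2_eq_square algebra_simps flip: exp_add)
    qed (use that d1 d2 in auto)
    thus ?thesis by (simp add: gauss_prim_0)
  qed
  have "norm (exp (z\<^sup>2) * of_real (sqrt pi / 2) - exp (z\<^sup>2) * gauss_prim z) \<le> Re (of_real (sqrt pi / 2))"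
  proof (rule tendsto_le)
    show "((\<lambda>x. norm (exp (z\<^sup>2) * gauss_prim (z + of_real x) - exp (z\<^sup>2) * gauss_prim z))
        \<longlongrightarrow> norm (exp (z\<^sup>2) * of_real (sqrt pi / 2) - exp (z\<^sup>2) * gauss_prim z)) at_top"
      by (intro tendsto_intros gauss_prim_add_of_real_tendsto assms)
    show "((\<lambda>x. Re (gauss_prim (of_real x))) \<longlongrightarrow> Re (of_real (sqrt pi / 2))) at_top"
      by (intro tendsto_Re gauss_prim_of_real_tendsto)
    show "\<forall>\<^sub>F x in at_top. norm (exp (z\<^sup>2) * gauss_prim (z + of_real x) - exp (z\<^sup>2) * gauss_prim z)
        \<le> Re (gauss_prim (of_real x))"
      using eventually_gt_at_top[of 0] by eventually_elim (rule le)
  qed auto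
  hence "2 / sqrt pi * norm (exp (z\<^sup>2) * of_real (sqrt pi / 2) - exp (z\<^sup>2) * gauss_prim z) \<le> 1"
    by (simp add: field_simps)
  moreover have "exp (z\<^sup>2) * erfc z
      = of_real (2 / sqrt pi) * (exp (z\<^sup>2) * of_real (sqrt pi / 2) - exp (z\<^sup>2) * gauss_prim z)"
    by (simp add: erfc_eq field_simps)
  ultimately show ?thesis
    by (simp only: norm_mult norm_of_real) simp
qed

text \<open>Where the argument \<open>w\<close> of \<open>erfc\<close> has negative real part, use
  \<open>erfc (- w) = 2 - erfc w\<close>; the extra term \<open>2 exp (w\<^sup>2)\<close> is bounded because there
  \<open>Re (w\<^sup>2) = Im (z\<^sup>2) \<le> 0\<close>.\<close>

lemma norm_FF_le:
  assumes "0 \<le> Re z"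
  shows "norm (FF z) \<le> 3 / 2"
proof -
  define w where "w = exp (- (\<i> * of_real pi / 4)) * z"
  have e: "exp (- (\<i> * of_real pi / 4)) = Complex (sqrt 2 / 2) (- sqrt 2 / 2)"
    using cis_conv_exp[of "- pi / 4"]
    by (auto simp: complex_eq_iff cos_45 sin_45 exp_eq_polar)
  have Re_w: "Re w = sqrt 2 / 2 * (Re z + Im z)"
    by (simp add: w_def e algebra_simps)
  have "w\<^sup>2 = - (\<i> * z\<^sup>2)"
  proof -
    have "(exp (- (\<i> * of_real pi / 4)))\<^sup>2 = - \<i>"
      unfolding e by (simp add: complex_eq_iff Re_power2 Im_power2 power2_eq_square)
    thus ?thesis by (simp add: w_def power_mult_distrib)
  qed
  hence FF: "FF z = exp (w\<^sup>2) * erfc w / 2"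
    by (simp add: FF_def Fr_def w_def)
  show ?thesis
  proof (cases "0 \<le> Re w")
    case True
    thus ?thesis using norm_exp_erfc_le_1[of w] by (simp add: FF norm_divide)
  next
    case False
    hence "Re z + Im z \<le> 0"
      by (simp add: Re_w zero_le_mult_iff)
    hence "Re (w\<^sup>2) \<le> 0"
      using assms by (simp add: \<open>w\<^sup>2 = _\<close> Im_power2 mult_nonneg_nonpos)
    hence 1: "norm (2 * exp (w\<^sup>2)) \<le> 2"
      by (simp add: norm_mult)
    have "exp (w\<^sup>2) * erfc w = 2 * exp (w\<^sup>2) - exp ((-w)\<^sup>2) * erfc (- w)"
      by (simp add: erfc_eq gauss_prim_minus algebra_simps)
    moreover have "norm (exp ((-w)\<^sup>2) * erfc (- w)) \<le> 1"
      using False by (intro norm_exp_erfc_le_1) auto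
    \<comment> \<open>The reflected value contributes 1 and the extra exponential 2; halving gives
      the constant \<open>3 / 2\<close>.\<close>
    ultimately have "norm (exp (w\<^sup>2) * erfc w) \<le> 3"
      using 1 norm_triangle_ineq4[of "2 * exp (w\<^sup>2)" "exp ((-w)\<^sup>2) * erfc (- w)"] by (simp only:)
    thus ?thesis by (simp add: FF norm_divide)
  qed
qed

lemma FF_holomorphic: "FF holomorphic_on A"
proof -
  have "gauss_prim holomorphic_on UNIV"
    using has_field_derivative_gauss_prim holomorphic_on_open by blast
  hence [holomorphic_intros]: "(\<lambda>z. gauss_prim (f z)) holomorphic_on A" if "f holomorphic_on A" for f
    using holomorphic_on_compose_gen[OF that] by (auto simp: o_def)
  show ?thesis
    unfolding FF_def Fr_def erfc_eq by (intro holomorphic_intros) auto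
qed

section \<open>The extremal cubic and the sector in Cartesian form\<close>

lemma golden_cubic_le:
  fixes c :: real
  assumes "0 < c"
  shows "(11 + 5 * sqrt 5) / 2 * (c\<^sup>2 * (1 - c)) \<le> 1 + c"
proof -
  \<comment> \<open>With \<open>g\<^sup>2 = 1 - g\<close> the constant becomes
    \<open>8 + 5 * g\<close>, so the factorisation below is a polynomial identity modulo this
    relation.\<close>
  define g :: real where "g = (sqrt 5 - 1) / 2"
  have g2: "g * g = 1 - g"
    by (simp add: g_def field_simps)
  have A: "(11 + 5 * sqrt 5) / 2 = 8 + 5 * g"
    by (simp add: g_def field_simps)
  have "2 < sqrt 5"
    by (rule real_less_rsqrt) simp
  hence g: "1 / 2 < g"
    by (simp add: g_def)
  \<comment> \<open>The cubic has a double zero at the inverse golden ratio \<open>g\<close>.\<close>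
  have "1 + c - (8 + 5 * g) * (c\<^sup>2 * (1 - c)) = (8 + 5 * g) * ((c - g)\<^sup>2 * (c + (2 * g - 1)))"
    using g2 by algebra
  \<comment> \<open>The third zero \<open>1 - 2 * g\<close> is negative, so the last factor is
    positive for \<open>c > 0\<close>.\<close>
  moreover have "0 \<le> (8 + 5 * g) * ((c - g)\<^sup>2 * (c + (2 * g - 1)))"
    using g assms by (intro mult_nonneg_nonneg) auto
  ultimately show ?thesis
    unfolding A by linarith
qed

text \<open>An open set that contains every \<open>S_region\<close> with
  \<open>\<delta> > 0\<close>. Holomorphy and the sign of \<open>Re mu\<close> are settled here;
  \<open>\<delta>\<close> enters only in the quantitative estimates.\<close>

definition wedge :: "real \<Rightarrow> real \<Rightarrow> complex set" where
  "wedge R \<beta> = {s. 0 < Re s \<and> \<bar>Im s\<bar> < sqrt ((11 + 5 * sqrt 5) / 2) * Re s \<and> \<bar>Im s\<bar> < R * sin \<beta>}"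

lemma open_wedge: "open (wedge R \<beta>)"
  unfolding wedge_def
  by (intro open_Collect_conj open_Collect_less continuous_on_const continuous_on_Re continuous_on_Im
      continuous_on_mult continuous_on_rabs continuous_on_id)

text \<open>The argument stays within \<open>pi / 2\<close> of zero, where the cosine is positive
  and the tangent increasing, so the bound on the angle becomes a bound on the slope.\<close>

lemma S_region_subset_wedge:
  assumes "0 \<le> R * sin \<beta>" "0 < \<delta>"
  shows "S_region \<delta> R \<beta> \<subseteq> wedge R \<beta>"
proof
  fix s assume s: "s \<in> S_region \<delta> R \<beta>"
  define A :: real where "A = sqrt ((11 + 5 * sqrt 5) / 2)"
  have "0 < A"
    by (simp add: A_def add_pos_pos)
  define a where "a = Arg s"
  have a: "\<bar>a\<bar> < arctan A" and "s \<noteq> 0"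
    using s by (auto simp: S_region_def A_def a_def)
  hence "0 < norm s"
    by simp
  have "\<bar>a\<bar> < pi / 2"
    using a arctan_ubound[of A] by linarith
  hence cos: "0 < cos a"
    by (intro cos_gt_zero_pi) auto
  have tan: "tan \<bar>a\<bar> < A"
    using a \<open>\<bar>a\<bar> < pi / 2\<close> tan_monotone[of "\<bar>a\<bar>" "arctan A"] arctan_ubound[of A]
    by (simp add: tan_arctan)
  have "s = rcis (norm s) a"
    by (simp add: a_def rcis_cmod_Arg)
  hence Re: "Re s = norm s * cos a" and Im: "Im s = norm s * sin a"
    by (metis Re_rcis, metis Im_rcis)
  have "\<bar>sin a\<bar> = tan \<bar>a\<bar> * cos a"
  proof -
    have "\<bar>sin a\<bar> = sin \<bar>a\<bar>"
      using sin_ge_zero[of "\<bar>a\<bar>"] \<open>\<bar>a\<bar> < pi / 2\<close> by (auto simp: abs_if split: if_splits)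
    thus ?thesis
      using cos by (simp add: tan_def)
  qed
  also have "\<dots> < A * cos a"
    using tan cos by (intro mult_strict_right_mono)
  finally have "\<bar>Im s\<bar> < A * Re s"
    using \<open>0 < norm s\<close> by (simp add: Re Im abs_mult)
  moreover have "0 < Re s"
    using \<open>0 < norm s\<close> cos by (simp add: Re)
  moreover have "\<bar>Im s\<bar> < R * sin \<beta>"
  proof -
    have "(1 - \<delta>) * (R * sin \<beta>) \<le> 1 * (R * sin \<beta>)"
      using assms by (intro mult_right_mono) auto
    thus ?thesis using s by (simp add: S_region_def mult.assoc)
  qed
  ultimately show "s \<in> wedge R \<beta>"
    by (simp add: wedge_def A_def)
qed

lemma Re_csqrt_pos: "0 < Re z \<Longrightarrow> 0 < Re (csqrt z)"
  using csqrt_in_nonpos_Reals_iff by (simp add: add_nonneg_pos)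

section \<open>Branches and signs of \<open>rr\<close> and \<open>mu\<close> for fixed
  \<open>R\<close> and \<open>\<beta>\<close>\<close>

locale screen =
  fixes R \<beta> :: real
  assumes R_pos: "0 < R" and \<beta>_pos: "0 < \<beta>" and \<beta>_less_pi: "\<beta> < pi"
begin

lemma sin_pos: "0 < sin \<beta>"
  using \<beta>_pos \<beta>_less_pi by (rule sin_gt_zero)

lemma cos_sq: "(cos \<beta>)\<^sup>2 = 1 - (sin \<beta>)\<^sup>2"
  by (simp add: cos_squared_eq)

lemma of_real_cos_sq: "(of_real (cos \<beta>) :: complex)\<^sup>2 = 1 - (of_real (sin \<beta>))\<^sup>2"
  unfolding of_real_power[symmetric] cos_sq by simp

lemma rr_sq: "(rr R \<beta> s)\<^sup>2 = of_real (R\<^sup>2) + s\<^sup>2 - 2 * s * of_real R * of_real (cos \<beta>)"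
  by (simp add: rr_def)

text \<open>Completing the square in \<open>Re s\<close> shows that the radicand has positive real
  part throughout the strip, away from the cut of \<open>csqrt\<close>.\<close>

lemma Re_rr_sq:
  "Re (of_real (R\<^sup>2) + s\<^sup>2 - 2 * s * of_real R * of_real (cos \<beta>))
     = (Re s - R * cos \<beta>)\<^sup>2 + (R * sin \<beta>)\<^sup>2 - (Im s)\<^sup>2"
  by (simp add: Re_power2 power2_diff power_mult_distrib cos_sq algebra_simps)

lemma Re_rr_sq_pos:
  assumes "\<bar>Im s\<bar> < R * sin \<beta>"
  shows "0 < Re (of_real (R\<^sup>2) + s\<^sup>2 - 2 * s * of_real R * of_real (cos \<beta>))"
proof -
  have "(Im s)\<^sup>2 < (R * sin \<beta>)\<^sup>2"
    using assms by (intro power2_strict_mono) auto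
  thus ?thesis
    unfolding Re_rr_sq by (smt (verit) zero_le_power2)
qed

lemma Re_rr_pos:
  assumes "\<bar>Im s\<bar> < R * sin \<beta>"
  shows "0 < Re (rr R \<beta> s)"
  unfolding rr_def by (intro Re_csqrt_pos Re_rr_sq_pos assms)

text \<open>For real \<open>s\<close> the radicand is
  \<open>(R - x * cos \<beta>)\<^sup>2 + (x * sin \<beta>)\<^sup>2\<close>, and its second term is
  positive. This settles the real case of the sign arguments for \<open>mu\<close>.\<close>

lemma rr_of_real:
  "\<exists>\<rho>. rr R \<beta> (of_real x) = of_real \<rho> \<and> \<bar>R - x * cos \<beta>\<bar> < \<rho>" if "0 < x"
proof -
  let ?y = "(R - x * cos \<beta>)\<^sup>2 + (x * sin \<beta>)\<^sup>2"
  have "rr R \<beta> (of_real x) = csqrt (of_real ?y)"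
    unfolding rr_def
    by (rule arg_cong[where f = csqrt])
       (simp add: power_mult_distrib power2_diff of_real_cos_sq algebra_simps)
  also have "\<dots> = of_real (sqrt ?y)"
    by (rule csqrt_of_real) auto
  finally have "rr R \<beta> (of_real x) = of_real (sqrt ?y)" .
  moreover have "\<bar>R - x * cos \<beta>\<bar> < sqrt ?y"
    using that sin_pos by (intro real_less_rsqrt) (auto simp: power2_eq_square)
  ultimately show ?thesis by blast
qed

text \<open>If the expression equals \<open>- p\<close> with \<open>p \<ge> 0\<close>, solve for
  \<open>rr\<close> and square. Off the real axis, the imaginary part determines
  \<open>p * cos \<beta>\<close>; the real part then equates \<open>p * (p + 2 * R) \<ge> 0\<close>
  with a negative number.\<close>

lemma mu_radicand_not_nonpos:
  assumes "0 < Re s" "\<bar>Im s\<bar> < R * sin \<beta>"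
  shows "of_real R - s * of_real (cos \<beta>) + rr R \<beta> s \<notin> \<real>\<^sub>\<le>\<^sub>0"
proof
  assume "of_real R - s * of_real (cos \<beta>) + rr R \<beta> s \<in> \<real>\<^sub>\<le>\<^sub>0"
  then obtain p where p: "0 \<le> p" "of_real R - s * of_real (cos \<beta>) + rr R \<beta> s = of_real (- p)"
    by (metis nonpos_Reals_cases minus_minus neg_0_le_iff_le)
  hence r: "rr R \<beta> s = s * of_real (cos \<beta>) - of_real R - of_real p"
    by (simp add: algebra_simps)
  have eq: "(s * of_real (cos \<beta>) - of_real R - of_real p)\<^sup>2
      = of_real (R\<^sup>2) + s\<^sup>2 - 2 * s * of_real R * of_real (cos \<beta>)"
    unfolding rr_sq[symmetric] r ..
  define x y where "x = Re s" and "y = Im s"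
  have "Im ((s * of_real (cos \<beta>) - of_real R - of_real p)\<^sup>2)
      = 2 * (x * cos \<beta> - R - p) * (y * cos \<beta>)"
    by (simp add: Im_power2 x_def y_def)
  moreover have "Re ((s * of_real (cos \<beta>) - of_real R - of_real p)\<^sup>2)
      = (x * cos \<beta> - R - p)\<^sup>2 - (y * cos \<beta>)\<^sup>2"
    by (simp add: Re_power2 x_def y_def)
  ultimately have Im: "2 * (x * cos \<beta> - R - p) * (y * cos \<beta>) = 2 * x * y - 2 * y * R * cos \<beta>"
    and Re: "(x * cos \<beta> - R - p)\<^sup>2 - (y * cos \<beta>)\<^sup>2 = R\<^sup>2 + x\<^sup>2 - y\<^sup>2 - 2 * x * R * cos \<beta>"
    unfolding eq by (simp_all add: Im_power2 Re_power2 x_def y_def)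
  have "x > 0" using assms by (simp add: x_def)
  show False
  proof (cases "y = 0")
    case True
    hence "s = of_real x"
      by (simp add: x_def y_def complex_eq_iff)
    then obtain \<rho> where \<rho>: "rr R \<beta> s = of_real \<rho>" "\<bar>R - x * cos \<beta>\<bar> < \<rho>"
      using rr_of_real \<open>x > 0\<close> by blast
    have "R - x * cos \<beta> + \<rho> = - p"
      using p(2) unfolding \<rho>(1) by (simp add: x_def complex_eq_iff)
    with p \<open>\<bar>R - x * cos \<beta>\<bar> < \<rho>\<close> show False by linarith
  next
    case False
    have "y * (x * (sin \<beta>)\<^sup>2 + p * cos \<beta>) = 0"
      using Im cos_sq by algebra
    hence pc: "p * cos \<beta> = - (x * (sin \<beta>)\<^sup>2)"
      using False by simp
    have "p * (p + 2 * R) = - ((sin \<beta>)\<^sup>2 * (x\<^sup>2 + y\<^sup>2))"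
      using Re pc cos_sq by algebra
    moreover have "0 \<le> p * (p + 2 * R)"
      using p R_pos by simp
    moreover have "0 < (sin \<beta>)\<^sup>2 * (x\<^sup>2 + y\<^sup>2)"
      using sin_pos \<open>x > 0\<close> by (simp add: add_pos_nonneg)
    ultimately show False by linarith
  qed
qed

lemma mu_of_real:
  assumes "0 < k" "0 < x"
  shows "0 < Re (mu k R \<beta> (of_real x))"
proof -
  obtain \<rho> where \<rho>: "rr R \<beta> (of_real x) = of_real \<rho>" "\<bar>R - x * cos \<beta>\<bar> < \<rho>"
    using rr_of_real assms by blast
  hence "csqrt (of_real R - of_real x * of_real (cos \<beta>) + rr R \<beta> (of_real x))
      = of_real (sqrt (R - x * cos \<beta> + \<rho>))"
    using csqrt_of_real[of "R - x * cos \<beta> + \<rho>"] by simp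
  hence "mu k R \<beta> (of_real x) = of_real (sqrt k * x * sin \<beta> / sqrt (R - x * cos \<beta> + \<rho>))"
    by (simp add: mu_def)
  thus ?thesis
    using assms \<rho> sin_pos by (simp only: Re_complex_of_real) (auto intro!: divide_pos_pos mult_pos_pos)
qed

lemma mu_sq:
  assumes "0 \<le> k" "of_real R - s * of_real (cos \<beta>) + rr R \<beta> s \<noteq> 0"
  shows "(mu k R \<beta> s)\<^sup>2 = of_real k * (rr R \<beta> s - of_real R + s * of_real (cos \<beta>))"
proof -
  have "(mu k R \<beta> s)\<^sup>2 = of_real k * (s\<^sup>2 * (of_real (sin \<beta>))\<^sup>2)
      / (of_real R - s * of_real (cos \<beta>) + rr R \<beta> s)"
    using assms by (simp add: mu_def power_mult_distrib power_divide flip: of_real_power)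
  also have "s\<^sup>2 * (of_real (sin \<beta>))\<^sup>2 = (rr R \<beta> s - of_real R + s * of_real (cos \<beta>))
      * (of_real R - s * of_real (cos \<beta>) + rr R \<beta> s)"
    using rr_sq[of s] of_real_cos_sq by (simp only: of_real_power) algebra
  finally show ?thesis
    using assms by simp
qed

text \<open>A purely imaginary \<open>mu\<close> has square \<open>- (k * p)\<close> with
  \<open>p \<ge> 0\<close>, which determines \<open>rr\<close>. Squaring that relation gives two
  real equations; the strip and the sector then bound the same parameter from opposite
  sides.\<close>

lemma Re_mu_neq_0:
  assumes "0 < k" "s \<in> wedge R \<beta>"
  shows "Re (mu k R \<beta> s) \<noteq> 0"
proof
  assume Re_mu: "Re (mu k R \<beta> s) = 0"
  define x y c where "x = Re s" and "y = Im s" and "c = cos \<beta>"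
  \<comment> \<open>Here \<open>A\<close> is the square of the slope bounding the wedge.\<close>
  define A :: real where "A = (11 + 5 * sqrt 5) / 2"
  have "0 < A" by (simp add: A_def add_pos_pos)
  have x: "0 < x" and yA: "\<bar>y\<bar> < sqrt A * x" and yR: "\<bar>y\<bar> < R * sin \<beta>"
    using assms by (auto simp: wedge_def x_def y_def A_def)
  have nz: "of_real R - s * of_real (cos \<beta>) + rr R \<beta> s \<noteq> 0"
    using mu_radicand_not_nonpos[of s] x yR by (auto simp: x_def y_def)
  define p where "p = (Im (mu k R \<beta> s))\<^sup>2 / k"
  have "0 \<le> p"
    using assms by (simp add: p_def)
  have "(mu k R \<beta> s)\<^sup>2 = of_real (- (k * p))"
    using Re_mu assms by (simp add: complex_eq_iff Re_power2 Im_power2 p_def)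
  hence "of_real k * (rr R \<beta> s - of_real R + s * of_real (cos \<beta>)) = of_real k * of_real (- p)"
    using mu_sq[OF _ nz, of k] assms by simp
  hence "rr R \<beta> s - of_real R + s * of_real (cos \<beta>) = of_real (- p)"
    using assms by (simp only: mult_cancel_left of_real_eq_0_iff) simp
  hence r: "rr R \<beta> s = of_real R - s * of_real c - of_real p"
    by (simp add: algebra_simps c_def)
  have eq: "(of_real R - s * of_real c - of_real p)\<^sup>2
      = of_real (R\<^sup>2) + s\<^sup>2 - 2 * s * of_real R * of_real c"
    unfolding c_def rr_sq[symmetric] r[unfolded c_def] ..
  have "Im ((of_real R - s * of_real c - of_real p)\<^sup>2)
      = 2 * (R - x * c - p) * (- y * c)"
    by (simp add: Im_power2 x_def y_def)
  moreover have "Re ((of_real R - s * of_real c - of_real p)\<^sup>2)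
      = (R - x * c - p)\<^sup>2 - (y * c)\<^sup>2"
    by (simp add: Re_power2 x_def y_def)
  ultimately have Im: "2 * (R - x * c - p) * (- y * c) = 2 * x * y - 2 * y * R * c"
    and Re: "(R - x * c - p)\<^sup>2 - (y * c)\<^sup>2 = R\<^sup>2 + x\<^sup>2 - y\<^sup>2 - 2 * x * R * c"
    unfolding eq by (simp_all add: Im_power2 Re_power2 x_def y_def)
  have c2: "c\<^sup>2 = 1 - (sin \<beta>)\<^sup>2"
    by (simp add: c_def cos_sq)
  show False
  proof (cases "y = 0")
    case True
    hence "s = of_real x"
      by (simp add: x_def y_def complex_eq_iff)
    thus False
      using mu_of_real[OF assms(1) x] Re_mu by simp
  next
    case False
    have "y * (x * (sin \<beta>)\<^sup>2 - p * c) = 0"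
      using Im c2 by algebra
    hence pc: "p * c = x * (sin \<beta>)\<^sup>2"
      using False by simp
    have "0 < p * c"
      unfolding pc using x sin_pos by simp
    hence "0 < c"
      using \<open>0 \<le> p\<close> by (simp add: zero_less_mult_iff)
    \<comment> \<open>The parameter \<open>u\<close> describes all solutions at once:
      \<open>x = u * c\<close>, \<open>p = u * (sin \<beta>)\<^sup>2\<close> and
      \<open>y\<^sup>2 = u * (2 * R - u)\<close>.\<close>
    define u where "u = x / c"
    have u: "x = u * c" "0 < u"
      using \<open>0 < c\<close> x by (auto simp: u_def)
    have pu: "p = u * (sin \<beta>)\<^sup>2"
      using pc \<open>0 < c\<close> by (simp add: u)
    \<comment> \<open>This is \<open>Re (rr R \<beta> s)\<close>. The resulting \<open>u < R\<close>
      selects the sign of \<open>R - u\<close> when square roots are taken in the strip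
      condition.\<close>
    have "0 < R - x * c - p"
      using Re_rr_pos[of s] yR by (simp add: r x_def y_def)
    also have "\<dots> = R - u"
      unfolding u pu using c2 by algebra
    finally have "u < R" by simp
    have "(sin \<beta>)\<^sup>2 * y\<^sup>2 = (sin \<beta>)\<^sup>2 * (2 * R * u - u\<^sup>2)"
      using Re c2 unfolding u pu by algebra
    hence y2: "y\<^sup>2 = 2 * R * u - u\<^sup>2"
      using sin_pos by simp
    have "y\<^sup>2 < (R * sin \<beta>)\<^sup>2"
      using power2_strict_mono[of y "R * sin \<beta>"] yR by simp
    moreover have "(R * c)\<^sup>2 = R\<^sup>2 - (R * sin \<beta>)\<^sup>2"
      using c2 by algebra
    moreover have "(R - u)\<^sup>2 = R\<^sup>2 - y\<^sup>2"
      using y2 by algebra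
    ultimately have "(R * c)\<^sup>2 < (R - u)\<^sup>2"
      by linarith
    hence uR: "u < R * (1 - c)"
      using \<open>u < R\<close> power2_less_imp_less[of "R * c" "R - u"] by (simp add: algebra_simps)
    have "y\<^sup>2 < (sqrt A * x)\<^sup>2"
      using power2_strict_mono[of y "sqrt A * x"] yA by simp
    also have "(sqrt A * x)\<^sup>2 = A * (u * c)\<^sup>2"
      using \<open>0 < A\<close> by (simp add: u power_mult_distrib)
    also have "\<dots> = u * (A * (u * c\<^sup>2))"
      by algebra
    also have "y\<^sup>2 = u * (2 * R - u)"
      using y2 by algebra
    \<comment> \<open>The sector condition divided by \<open>u\<close>. With the strip bound
      \<open>u < R * (1 - c)\<close> on the right and the cubic inequality, it forces
      \<open>u > R * (1 - c)\<close>.\<close>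
    finally have "2 * R - u < A * (u * c\<^sup>2)"
      using \<open>0 < u\<close> by simp
    also have "\<dots> \<le> A * (R * (1 - c) * c\<^sup>2)"
      using uR \<open>0 < A\<close> by (intro mult_left_mono mult_right_mono) auto
    also have "\<dots> = R * (A * (c\<^sup>2 * (1 - c)))"
      by simp
    also have "\<dots> \<le> R * (1 + c)"
      using golden_cubic_le[OF \<open>0 < c\<close>] R_pos by (intro mult_left_mono) (auto simp: A_def)
    finally show False
      using uR by (simp add: algebra_simps)
  qed
qed

section \<open>Holomorphy on the wedge and positivity of \<open>Re mu\<close>\<close>

lemma rr_holomorphic: "rr R \<beta> holomorphic_on wedge R \<beta>"
proof -
  have "of_real (R\<^sup>2) + s\<^sup>2 - 2 * s * of_real R * of_real (cos \<beta>) \<notin> \<real>\<^sub>\<le>\<^sub>0" if "s \<in> wedge R \<beta>" for s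
    using Re_rr_sq_pos[of s] that by (auto simp: wedge_def complex_nonpos_Reals_iff)
  thus ?thesis
    unfolding rr_def by (intro holomorphic_intros) auto
qed

lemma mu_radicand_wedge:
  "s \<in> wedge R \<beta> \<Longrightarrow> of_real R - s * of_real (cos \<beta>) + rr R \<beta> s \<notin> \<real>\<^sub>\<le>\<^sub>0"
  by (rule mu_radicand_not_nonpos) (auto simp: wedge_def)

lemma mu_holomorphic: "mu k R \<beta> holomorphic_on wedge R \<beta>"
proof -
  have "csqrt (of_real R - s * of_real (cos \<beta>) + rr R \<beta> s) \<noteq> 0" if "s \<in> wedge R \<beta>" for s
    using mu_radicand_wedge[OF that] by auto
  thus ?thesis
    unfolding mu_def using mu_radicand_wedge by (intro holomorphic_intros rr_holomorphic) auto
qed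

text \<open>The vertical segment from \<open>Re s\<close> to \<open>s\<close> stays in the wedge.
  The real part of \<open>mu\<close> is positive at its real end, so a nonpositive value at
  \<open>s\<close> would force a zero in between by the intermediate value theorem.\<close>

lemma Re_mu_pos:
  assumes "0 < k" "s \<in> wedge R \<beta>"
  shows "0 < Re (mu k R \<beta> s)"
proof (rule ccontr)
  assume neg: "\<not> 0 < Re (mu k R \<beta> s)"
  define \<gamma> where "\<gamma> t = Complex (Re s) (t * Im s)" for t
  define \<phi> where "\<phi> t = Re (mu k R \<beta> (\<gamma> t))" for t
  have \<gamma>: "\<gamma> t \<in> wedge R \<beta>" if "0 \<le> t" "t \<le> 1" for t
  proof -
    have "\<bar>t * Im s\<bar> \<le> 1 * \<bar>Im s\<bar>"
      unfolding abs_mult using that by (intro mult_right_mono) auto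
    thus ?thesis using assms by (auto simp: wedge_def \<gamma>_def)
  qed
  have "continuous_on {0..1} \<phi>"
    unfolding \<phi>_def
    by (intro continuous_intros continuous_on_compose2[OF holomorphic_on_imp_continuous_on[OF mu_holomorphic]])
       (use \<gamma> in \<open>auto simp: \<gamma>_def Complex_eq intro!: continuous_intros\<close>)
  moreover have "0 < \<phi> 0"
    using assms mu_of_real[of k "Re s"] by (simp add: \<phi>_def \<gamma>_def wedge_def complex_of_real_def)
  moreover have "\<phi> 1 \<le> 0"
    using neg by (simp add: \<phi>_def \<gamma>_def)
  ultimately obtain t where "0 \<le> t" "t \<le> 1" "\<phi> t = 0"
    using IVT2'[of \<phi> 1 0 0] by auto
  thus False
    using Re_mu_neq_0[OF assms(1) \<gamma>] by (simp add: \<phi>_def)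
qed

lemma gg_holomorphic:
  assumes "0 < k"
  shows "gg k R \<beta> holomorphic_on wedge R \<beta>"
proof -
  have nz: "mu k R \<beta> s \<noteq> 0" "rr R \<beta> s \<noteq> 0" if "s \<in> wedge R \<beta>" for s
    using Re_mu_pos[OF assms that] Re_rr_pos[of s] that by (auto simp: wedge_def)
  have "h_formula k R \<beta> holomorphic_on wedge R \<beta>"
    unfolding h_formula_def using nz by (intro holomorphic_intros rr_holomorphic mu_holomorphic) auto
  \<comment> \<open>The wedge omits the origin, so \<open>hh\<close> coincides there with
    \<open>h_formula\<close>.\<close>
  hence hh: "hh k R \<beta> holomorphic_on wedge R \<beta>"
    by (rule holomorphic_transform) (auto simp: hh_def wedge_def)
  have "(FF \<circ> mu k R \<beta>) holomorphic_on wedge R \<beta>"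
    by (rule holomorphic_on_compose[OF mu_holomorphic FF_holomorphic])
  hence "ff k R \<beta> holomorphic_on wedge R \<beta>"
    by (simp add: o_def ff_def[abs_def])
  with hh show ?thesis
    unfolding gg_def by (intro holomorphic_intros) auto
qed

section \<open>Quantitative bounds for \<open>h\<close> and \<open>g\<close>\<close>

lemma norm_rr_ge:
  assumes "0 \<le> \<delta>" "\<delta> \<le> 1" "\<bar>Im s\<bar> \<le> (1 - \<delta>) * (R * sin \<beta>)"
  shows "\<delta> * (R * sin \<beta>) \<le> norm (rr R \<beta> s)"
proof -
  let ?q = "of_real (R\<^sup>2) + s\<^sup>2 - 2 * s * of_real R * of_real (cos \<beta>)"
  have "(Im s)\<^sup>2 \<le> (1 - \<delta>)\<^sup>2 * (R * sin \<beta>)\<^sup>2"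
    using power_mono[OF assms(3), of 2] by (simp add: power_mult_distrib)
  moreover have "\<delta>\<^sup>2 * (R * sin \<beta>)\<^sup>2 \<le> (1 - (1 - \<delta>)\<^sup>2) * (R * sin \<beta>)\<^sup>2"
  proof (intro mult_right_mono zero_le_power2)
    have "\<delta> * \<delta> \<le> \<delta> * 1"
      using assms by (intro mult_left_mono) auto
    thus "\<delta>\<^sup>2 \<le> 1 - (1 - \<delta>)\<^sup>2"
      by (simp add: power2_eq_square algebra_simps)
  qed
  \<comment> \<open>The square involving \<open>Re s\<close> is dropped; what remains of
    \<open>(R * sin \<beta>)\<^sup>2 - (Im s)\<^sup>2\<close> is at least a
    \<open>\<delta>\<^sup>2\<close> share. The left side is then compared with
    \<open>norm ((rr R \<beta> s)\<^sup>2)\<close> through its real part.\<close>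
  ultimately have "(\<delta> * (R * sin \<beta>))\<^sup>2 \<le> (Re s - R * cos \<beta>)\<^sup>2 + (R * sin \<beta>)\<^sup>2 - (Im s)\<^sup>2"
    using zero_le_power2[of "Re s - R * cos \<beta>"] unfolding left_diff_distrib power_mult_distrib[of \<delta>]
    by linarith
  also have "\<dots> \<le> norm ((rr R \<beta> s)\<^sup>2)"
    using complex_Re_le_cmod[of ?q] unfolding rr_sq Re_rr_sq .
  finally show ?thesis
    unfolding norm_power by (rule power2_le_imp_le) simp
qed

text \<open>After cancelling \<open>s\<close>, the factor \<open>s - 2 * R * cos \<beta>\<close> is
  absorbed by \<open>r + R\<close>, and \<open>sqrt (norm D)\<close> by part of
  \<open>norm r\<close>. A single \<open>sqrt (norm r)\<close> stays in the denominator and is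
  bounded below. Both estimates go through
  \<open>w\<^sup>2 = r\<^sup>2 - (R * sin \<beta>)\<^sup>2\<close>.\<close>

lemma norm_h_formula_le:
  assumes "0 < k" "0 < \<delta>" "\<delta> \<le> 1" "s \<in> wedge R \<beta>" "\<bar>Im s\<bar> \<le> (1 - \<delta>) * (R * sin \<beta>)"
  shows "norm (h_formula k R \<beta> s) \<le> 3 / \<delta> * (k / sqrt (k * R * sin \<beta>))"
proof -
  define r where "r = rr R \<beta> s"
  define D where "D = of_real R - s * of_real (cos \<beta>) + r"
  define w where "w = s - of_real (R * cos \<beta>)"
  have D: "D \<noteq> 0"
    using mu_radicand_wedge[OF assms(4)] by (auto simp: D_def r_def)
  have s: "s \<noteq> 0" and Im_s: "\<bar>Im s\<bar> < R * sin \<beta>"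
    using assms by (auto simp: wedge_def)
  have Re_r: "0 < Re r"
    unfolding r_def by (rule Re_rr_pos[OF Im_s])
  have Rs: "0 < R * sin \<beta>"
    using R_pos sin_pos by simp
  have r: "\<delta> * (R * sin \<beta>) \<le> norm r"
    unfolding r_def using assms by (intro norm_rr_ge) auto
  have rR: "R \<le> norm (r + of_real R)"
    using complex_Re_le_cmod[of "r + of_real R"] Re_r by simp
  have "norm r \<le> norm (r + of_real R)"
    unfolding norm_complex_def using Re_r R_pos by (auto intro!: power_mono)
  have "norm w \<le> norm r + R * sin \<beta>"
  proof (rule power2_le_imp_le)
    have "w\<^sup>2 = r\<^sup>2 - of_real ((R * sin \<beta>)\<^sup>2)"
      unfolding r_def rr_sq w_def using of_real_cos_sq
      by (simp only: of_real_mult of_real_power) algebra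
    moreover have "norm (of_real ((R * sin \<beta>)\<^sup>2) :: complex) = (R * sin \<beta>)\<^sup>2"
      by (simp only: norm_of_real) simp
    ultimately have "(norm w)\<^sup>2 \<le> (norm r)\<^sup>2 + (R * sin \<beta>)\<^sup>2"
      using norm_triangle_ineq4[of "r\<^sup>2" "of_real ((R * sin \<beta>)\<^sup>2)"]
      by (metis norm_power)
    also have "\<dots> \<le> (norm r + R * sin \<beta>)\<^sup>2"
      using Rs by (simp add: power2_sum)
    finally show "(norm w)\<^sup>2 \<le> (norm r + R * sin \<beta>)\<^sup>2" .
  qed (use Rs in auto)
  \<comment> \<open>The 3 counts \<open>norm r\<close>, \<open>R * sin \<beta>\<close> and
    \<open>R\<close>, each at most \<open>norm (r + R)\<close>.\<close>
  have N1: "norm (s - of_real (2 * R * cos \<beta>)) \<le> 3 * norm (r + of_real R)"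
  proof -
    have "norm (s - of_real (2 * R * cos \<beta>)) = norm (w - of_real (R * cos \<beta>))"
      by (simp add: w_def algebra_simps)
    also have "\<dots> \<le> norm w + \<bar>R * cos \<beta>\<bar>"
      by (metis norm_of_real norm_triangle_ineq4)
    also have "\<bar>R * cos \<beta>\<bar> \<le> R * 1"
      unfolding abs_mult using R_pos by (intro mult_mono) auto
    finally have "norm (s - of_real (2 * R * cos \<beta>)) \<le> norm w + R * 1" by simp
    moreover have "R * sin \<beta> \<le> R * 1"
      using R_pos by (intro mult_left_mono) auto
    ultimately show ?thesis
      using \<open>norm w \<le> _\<close> \<open>norm r \<le> _\<close> rR by linarith
  qed
  \<comment> \<open>In units of \<open>norm r / \<delta>\<close>, the term with
    \<open>(sin \<beta>)\<^sup>2\<close> costs 1, \<open>w\<close> costs 2 and \<open>r\<close>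
    costs 1.\<close>
  have N2: "norm D \<le> 4 / \<delta> * norm r"
  proof -
    have D_eq: "D = of_real (R * (sin \<beta>)\<^sup>2) - of_real (cos \<beta>) * w + r"
      unfolding D_def w_def using of_real_cos_sq
      by (simp only: of_real_mult of_real_power) algebra
    have "norm D \<le> norm (of_real (R * (sin \<beta>)\<^sup>2) - of_real (cos \<beta>) * w) + norm r"
      unfolding D_eq by (rule norm_triangle_ineq)
    moreover have "norm (of_real (R * (sin \<beta>)\<^sup>2) - of_real (cos \<beta>) * w)
        \<le> norm (of_real (R * (sin \<beta>)\<^sup>2) :: complex) + norm (of_real (cos \<beta>) * w)"
      by (rule norm_triangle_ineq4)
    moreover have "norm (of_real (cos \<beta>) * w) \<le> 1 * norm w"
      unfolding norm_mult by (intro mult_right_mono) auto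
    moreover have "norm (of_real (R * (sin \<beta>)\<^sup>2) :: complex) \<le> R * sin \<beta>"
    proof -
      have "norm (of_real (R * (sin \<beta>)\<^sup>2) :: complex) = R * sin \<beta> * sin \<beta>"
        using R_pos by (simp only: norm_of_real) (simp add: power2_eq_square)
      also have "\<dots> \<le> R * sin \<beta> * 1"
        using Rs by (intro mult_left_mono) auto
      finally show ?thesis by simp
    qed
    moreover have "R * sin \<beta> \<le> norm r / \<delta>"
      using r assms by (simp add: field_simps)
    moreover have "norm r \<le> norm r / \<delta>"
      using assms mult_right_mono[of \<delta> 1 "norm r"] by (simp add: field_simps)
    ultimately have "norm D \<le> 4 * (norm r / \<delta>)"
      using \<open>norm w \<le> _\<close> by linarith
    thus ?thesis by simp
  qed
  have r0: "0 < norm r" and r0': "r \<noteq> 0"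
    using Re_r by auto
  have rR0: "0 < norm (r + of_real R)"
    using rR R_pos by linarith
  hence rR0': "r + of_real R \<noteq> 0" by auto
  \<comment> \<open>This difference of squares exposes the factor \<open>s\<close> that cancels
    against the one in \<open>mu\<close>.\<close>
  have "(r - of_real R) * (r + of_real R) = s * (s - of_real (2 * R * cos \<beta>))"
    using rr_sq[of s] unfolding r_def[symmetric] by (simp add: algebra_simps power2_eq_square)
  hence rmR: "r - of_real R = s * (s - of_real (2 * R * cos \<beta>)) / (r + of_real R)"
    using rR0' by (simp add: field_simps)
  have kk: "of_real k = (of_real (sqrt k) * of_real (sqrt k) :: complex)"
    using assms by (simp flip: of_real_mult)
  have "h_formula k R \<beta> s = of_real (sqrt k) * (s - of_real (2 * R * cos \<beta>)) * csqrt D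
      / (2 * r * (r + of_real R))"
    unfolding h_formula_def mu_def r_def[symmetric] D_def[symmetric] rmR kk
    using s sin_pos assms r0' rR0' D by (simp add: divide_simps)
  hence "norm (h_formula k R \<beta> s) = sqrt k * norm (s - of_real (2 * R * cos \<beta>)) * sqrt (norm D)
      / (2 * norm r * norm (r + of_real R))"
    using assms by (simp only: norm_mult norm_divide norm_of_real norm_csqrt) simp
  \<comment> \<open>The factor 2 from \<open>sqrt (4 / \<delta>)\<close> will cancel the 2 in the
    denominator.\<close>
  also have "\<dots> \<le> sqrt k * (3 * norm (r + of_real R)) * sqrt (4 / \<delta> * norm r)
      / (2 * norm r * norm (r + of_real R))"
    using N1 N2 assms by (intro divide_right_mono mult_mono) auto
  also have "\<dots> = 3 * sqrt k * sqrt (norm r) / (sqrt \<delta> * (sqrt (norm r) * sqrt (norm r)))"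
    using rR0 assms by (simp add: real_sqrt_mult real_sqrt_divide field_simps)
  also have "\<dots> = 3 * sqrt k / (sqrt \<delta> * sqrt (norm r))"
    using mult_divide_mult_cancel_right[of "sqrt (norm r)" "3 * sqrt k" "sqrt \<delta> * sqrt (norm r)"] r0
    by (simp add: mult.assoc)
  also have "\<dots> \<le> 3 * sqrt k / (sqrt \<delta> * sqrt (\<delta> * (R * sin \<beta>)))"
    using r r0' assms Rs by (intro divide_left_mono mult_left_mono mult_pos_pos) auto
  also have "\<dots> = 3 / \<delta> * (sqrt k / sqrt (R * sin \<beta>))"
    using assms by (simp add: real_sqrt_mult flip: mult.assoc)
  also have "sqrt k / sqrt (R * sin \<beta>) = k / sqrt (k * R * sin \<beta>)"
    using assms by (simp add: real_sqrt_mult[of k] mult.assoc real_div_sqrt flip: divide_divide_eq_left)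
  finally show ?thesis .
qed

lemma norm_gg_le:
  assumes "0 < k" "0 < \<delta>" "\<delta> < 1" "s \<in> S_region \<delta> R \<beta>"
  shows "norm (gg k R \<beta> s) \<le> 3 / \<delta> * k * (1 + 1 / sqrt (k * R * sin \<beta>))"
proof -
  have s: "s \<in> wedge R \<beta>"
    using S_region_subset_wedge[of R \<beta> \<delta>] R_pos sin_pos assms by auto
  have "1 \<le> sqrt pi"
    using pi_ge_two by simp
  have "norm (hh k R \<beta> s) \<le> 3 / \<delta> * (k / sqrt (k * R * sin \<beta>))"
    using norm_h_formula_le[of k \<delta> s] assms s by (auto simp: hh_def S_region_def mult.assoc)
  moreover have "norm (hh k R \<beta> s) / sqrt pi \<le> norm (hh k R \<beta> s) / 1"
    using \<open>1 \<le> sqrt pi\<close> by (intro divide_left_mono) auto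
  moreover have "norm (exp (3 * of_real pi * \<i> / 4)) = 1"
    by simp
  ultimately have 1: "norm (exp (3 * of_real pi * \<i> / 4) / of_real (sqrt pi) * hh k R \<beta> s)
      \<le> 3 / \<delta> * (k / sqrt (k * R * sin \<beta>))"
    by (simp add: norm_mult norm_divide)
  have "norm (\<i> * of_real k * of_real (sin \<beta>) * ff k R \<beta> s) \<le> k * 1 * (3 / 2)"
    unfolding norm_mult ff_def using assms Re_mu_pos[OF assms(1) s]
    by (intro mult_mono norm_FF_le) auto
  \<comment> \<open>Since \<open>\<delta> < 1\<close>, the constant of the \<open>h\<close> term
    also covers the \<open>f\<close> term.\<close>
  also have "k * 1 * (3 / 2) \<le> k * (3 / \<delta>)"
    using assms by (simp add: field_simps)
  finally have 2: "norm (\<i> * of_real k * of_real (sin \<beta>) * ff k R \<beta> s) \<le> k * (3 / \<delta>)" .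
  have "norm (gg k R \<beta> s) \<le> 3 / \<delta> * (k / sqrt (k * R * sin \<beta>)) + k * (3 / \<delta>)"
    unfolding gg_def by (rule order_trans[OF norm_triangle_ineq4 add_mono[OF 1 2]])
  thus ?thesis
    by (simp add: algebra_simps)
qed

end

theorem theorem3p7:
  fixes \<delta> :: real
  assumes "0 < \<delta>" and "\<delta> < 1"
  shows "\<exists>C>0. \<forall>k>0. \<forall>R>0. \<forall>\<beta>. 0 < \<beta> \<and> \<beta> < pi \<longrightarrow>
           gg k R \<beta> analytic_on S_region \<delta> R \<beta> \<and>
           bounded (gg k R \<beta> ` S_region \<delta> R \<beta>) \<and>
           (\<forall>s\<in>S_region \<delta> R \<beta>.
              norm (gg k R \<beta> s) \<le> C * k * (1 + 1 / sqrt (k * R * sin \<beta>)))"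
proof (intro exI[of _ "3 / \<delta>"] conjI allI impI ballI)
  show "0 < 3 / \<delta>" using assms by simp
  fix k R \<beta> :: real
  assume k: "0 < k" and "0 < R" "0 < \<beta> \<and> \<beta> < pi"
  then interpret screen R \<beta> by unfold_locales auto
  show bnd: "norm (gg k R \<beta> s) \<le> 3 / \<delta> * k * (1 + 1 / sqrt (k * R * sin \<beta>))"
    if "s \<in> S_region \<delta> R \<beta>" for s
    using norm_gg_le k assms that by blast
  show "bounded (gg k R \<beta> ` S_region \<delta> R \<beta>)"
    using bnd by (auto simp: bounded_iff)
  \<comment> \<open>Analyticity on a set means holomorphy near each of its points, so it passes from
    the open wedge to the region.\<close>
  have "gg k R \<beta> analytic_on wedge R \<beta>"
    using gg_holomorphic[OF k] open_wedge by (simp add: analytic_on_open)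
  thus "gg k R \<beta> analytic_on S_region \<delta> R \<beta>"
    by (rule analytic_on_subset) (use S_region_subset_wedge R_pos sin_pos assms in auto)
qed

end
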